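(* There exists $\theta\in\mathbb{R}$ such that the set $\mathsf{B}=\{B_0,B_1\}\subset M_6(\mathbb{R})$ defined by \[B_0:=\begin{pmatrix}0&0&0&1&0&0\\0&0&0&0&1&0\\0&0&0&0&0&1\\1&0&0&0&0&0\\0&1&0&0&0&0\\0&0&1&0&0&0\end{pmatrix},\qquad B_1:=\begin{pmatrix}1&0&0&0&0&0\\0&1&0&0&0&0\\0&0&0&0&0&0\\0&0&0&1&\sin\theta&\cos\theta-1\\0&0&0&0&\cos\theta&-\sin\theta\\0&0&0&0&\sin\theta&\cos\theta\end{pmatrix}\] satisfies $\varrho(\mathsf{B})=1$ and has marginal instability rate sequence $(b_n)$ (with respect to any norm on $M_6(\mathbb{R})$) satisfying $b_n\simeq n^{1/3}$.
   Context: $M_d(\mathbb{R})$ is the set of $d\times d$ real matrices and $\|\cdot\|$ is the Euclidean operator norm. For $\mathsf{B}\subset M_d(\mathbb{R})$ and $n\geq 1$, $\mathsf{B}_n:=\{B_1\cdots B_n\colon B_i\in\mathsf{B}\}$ (products of $n$ elements of $\mathsf{B}$). The joint spectral radius of a bounded nonempty set $\mathsf{B}$ is $\varrho(\mathsf{B})=\lim_{n\to\infty}\sup_{B\in\mathsf{B}_n}\|B\|^{1/n}$. If $\varrho(\mathsf{B})=1$, the marginal instability rate sequence of $\mathsf{B}$ with respect to a norm $|||\cdot|||$ on $M_d(\mathbb{R})$ is $(b_n)_{n=1}^\infty$ with $b_n=\max_{B\in\mathsf{B}_n}|||B|||$. For sequences of positive reals, $b_n\simeq c_n$ means there is $C>0$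 with $C^{-1}c_n\leq b_n\leq Cc_n$ for all $n\geq 1$. *)

theory Defs
  imports "HOL-Analysis.Analysis"
begin

definition matrix_products :: "(real^'d^'d) set \<Rightarrow> nat \<Rightarrow> (real^'d^'d) set" where
  "matrix_products \<B> n = {foldr (**) As (mat 1) | As. length As = n \<and> set As \<subseteq> \<B>}"

(* The library norm on real^'d^'d is the Frobenius norm, so the Euclidean operator norm
   has to be written as onorm of the map x |-> A *v x. *)
definition operator_norm :: "real^'d^'d \<Rightarrow> real" where
  "operator_norm A = onorm (\<lambda>x. A *v x)"

(* Intended for bounded nonempty sets. The term at n = 0 is irrelevant for the limit. *)
definition joint_spectral_radius :: "(real^'d^'d) set \<Rightarrow> real" where
  "joint_spectral_radius \<B> =
     lim (\<lambda>n. SUP A\<in>matrix_products \<B> n. operator_norm A powr (1 / real n))"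

definition is_norm :: "('v::real_vector \<Rightarrow> real) \<Rightarrow> bool" where
  "is_norm N \<longleftrightarrow>
     (\<forall>x. 0 \<le> N x) \<and> (\<forall>x. N x = 0 \<longleftrightarrow> x = 0) \<and>
     (\<forall>c x. N (c *\<^sub>R x) = \<bar>c\<bar> * N x) \<and> (\<forall>x y. N (x + y) \<le> N x + N y)"

(* GREATEST is the maximum; it is used instead of Max because Max is only
   meaningful on finite sets. *)
definition marginal_instability_rate ::
  "(real^'d^'d \<Rightarrow> real) \<Rightarrow> (real^'d^'d) set \<Rightarrow> nat \<Rightarrow> real" where
  "marginal_instability_rate N \<B> n = (GREATEST r. r \<in> N ` matrix_products \<B> n)"

lemma finite_matrix_products:
  assumes "finite \<B>"
  shows "finite (matrix_products \<B> n)"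
proof -
  have "matrix_products \<B> n = (\<lambda>As. foldr (**) As (mat 1)) ` {As. set As \<subseteq> \<B> \<and> length As = n}"
    by (auto simp: matrix_products_def)
  then show ?thesis
    using finite_lists_length_eq[OF assms] by simp
qed

lemma matrix_products_nonempty:
  assumes "\<B> \<noteq> {}"
  shows "matrix_products \<B> n \<noteq> {}"
proof -
  obtain A where "A \<in> \<B>"
    using assms by blast
  then have "foldr (**) (replicate n A) (mat 1) \<in> matrix_products \<B> n"
    unfolding matrix_products_def by (auto intro!: exI[of _ "replicate n A"])
  then show ?thesis
    by blast
qed

lemma marginal_instability_rate_eq_Max:
  assumes "finite \<B>" "\<B> \<noteq> {}"
  shows "marginal_instability_rate N \<B> n = Max (N ` matrix_products \<B> n)"
  unfolding marginal_instability_rate_def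
  using finite_matrix_products[OF assms(1)] matrix_products_nonempty[OF assms(2)]
  by (intro Greatest_equality) (simp_all add: Max_in)

(* Indices start at 1. For c with positive terms this also forces b to be positive. *)
definition seq_equiv :: "(nat \<Rightarrow> real) \<Rightarrow> (nat \<Rightarrow> real) \<Rightarrow> bool" (infix "\<simeq>" 50) where
  "b \<simeq> c \<longleftrightarrow> (\<exists>C>0. \<forall>n\<ge>1. inverse C * c n \<le> b n \<and> b n \<le> C * c n)"

(* The components of vector [x1, ..., x6] :: _^6 are indexed from 1 to 6, where 6 = 0
   in the index type, so matrices below are lists of rows read in the usual order. *)
definition B0 :: "real^6^6" where
  "B0 = vector
    [vector [0, 0, 0, 1, 0, 0],
     vector [0, 0, 0, 0, 1, 0],
     vector [0, 0, 0, 0, 0, 1],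
     vector [1, 0, 0, 0, 0, 0],
     vector [0, 1, 0, 0, 0, 0],
     vector [0, 0, 1, 0, 0, 0]]"

definition B1 :: "real \<Rightarrow> real^6^6" where
  "B1 \<theta> = vector
    [vector [1, 0, 0, 0, 0, 0],
     vector [0, 1, 0, 0, 0, 0],
     vector [0, 0, 0, 0, 0, 0],
     vector [0, 0, 0, 1, sin \<theta>, cos \<theta> - 1],
     vector [0, 0, 0, 0, cos \<theta>, - sin \<theta>],
     vector [0, 0, 0, 0, sin \<theta>, cos \<theta>]]"

end

theory Submission
  imports Defs
begin

text \<open>
  Split a row vector of length 6 into two blocks \<open>(\<alpha>, \<beta>, \<gamma>)\<close>. Multiplication by \<open>B0\<close> from the right swaps
  the blocks; \<open>B1 \<theta>\<close> sets \<open>\<gamma>\<close> to \<open>0\<close> in the first block and rotates \<open>(\<beta>, \<gamma> + \<alpha>)\<close> by \<open>\<theta>\<close> in the second,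
  while \<open>\<alpha>\<close> never changes. So \<open>k\<close> rotations between two projections turn \<open>\<beta>\<close> into
  \<open>\<beta> * cos (k * \<theta>) + \<alpha> * sin (k * \<theta>)\<close>, which increases \<open>\<bar>\<beta>\<bar> ^ 3\<close> by at most a constant times
  \<open>1 / \<bar>sin (k * \<theta>)\<bar>\<close>. For \<open>\<theta> = 2 * pi * sqrt 2\<close> this is \<open>O(k)\<close>, because \<open>sqrt 2\<close> is badly approximable;
  hence \<open>\<bar>\<beta>\<bar> ^ 3 = O(n)\<close>.

  Conversely, Dirichlet's theorem gives \<open>k = O(N)\<close> with \<open>\<bar>sin (k * \<theta>)\<bar>\<close> of order \<open>1 / N\<close>. Repeating \<open>N\<^sup>2\<close>
  times the projection followed by \<open>k\<close> rotations takes \<open>O(N ^ 3)\<close> letters and makes \<open>\<beta>\<close> of order \<open>N\<close>.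
\<close>

section \<open>Row vectors of length 6 and the action of the two matrices\<close>

lemma exhaust_6:
  fixes x :: 6
  shows "x = 1 \<or> x = 2 \<or> x = 3 \<or> x = 4 \<or> x = 5 \<or> x = 6"
proof (induct x)
  case (of_int z)
  then have "z = 0 \<or> z = 1 \<or> z = 2 \<or> z = 3 \<or> z = 4 \<or> z = 5" by fastforce
  then show ?case by auto
qed

lemma forall_6: "(\<forall>i::6. P i) \<longleftrightarrow> P 1 \<and> P 2 \<and> P 3 \<and> P 4 \<and> P 5 \<and> P 6"
  by (metis exhaust_6)

lemma UNIV_6: "UNIV = {1, 2, 3, 4, 5, 6::6}"
  using exhaust_6 by auto

lemma sum_6: "sum f (UNIV::6 set) = f 1 + f 2 + f 3 + f 4 + f 5 + f 6"
  unfolding UNIV_6 by (simp add: ac_simps)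

lemma vector_6 [simp]:
  "(vector [a,b,c,d,e,f] :: 'a::zero^6)$1 = a"
  "(vector [a,b,c,d,e,f] :: 'a::zero^6)$2 = b"
  "(vector [a,b,c,d,e,f] :: 'a::zero^6)$3 = c"
  "(vector [a,b,c,d,e,f] :: 'a::zero^6)$4 = d"
  "(vector [a,b,c,d,e,f] :: 'a::zero^6)$5 = e"
  "(vector [a,b,c,d,e,f] :: 'a::zero^6)$6 = f"
  by (simp_all add: vector_def)

lemma vector_mult_B0:
  "v v* B0 = vector [v$4, v$5, v$6, v$1, v$2, v$3]"
  by (simp add: vec_eq_iff forall_6 vector_matrix_mult_def sum_6 B0_def)

lemma vector_mult_B1:
  "v v* B1 \<theta> = vector [v$1, v$2, 0, v$4,
     v$5 * cos \<theta> + (v$6 + v$4) * sin \<theta>,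
     - v$5 * sin \<theta> + (v$6 + v$4) * cos \<theta> - v$4]"
  by (simp add: vec_eq_iff forall_6 vector_matrix_mult_def sum_6 B1_def algebra_simps)

lemma axis_vector_matrix_mult: "(axis i 1 v* A) $ j = (A :: 'a::semiring_1^'n^'m) $ i $ j"
  by (simp add: vector_matrix_mult_def axis_def if_distrib[of "\<lambda>x. x * _"] if_distrib[of "\<lambda>x. _ * x"]
      cong: if_cong)

section \<open>Upper bound for the entries of products\<close>

lemma sin_cos_Suc_mult:
  fixes \<theta> :: real
  shows "sin (real (Suc k) * \<theta>) = sin (real k * \<theta>) * cos \<theta> + cos (real k * \<theta>) * sin \<theta>"
    and "cos (real (Suc k) * \<theta>) = cos (real k * \<theta>) * cos \<theta> - sin (real k * \<theta>) * sin \<theta>"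
  using sin_add[of "real k * \<theta>" \<theta>] cos_add[of "real k * \<theta>" \<theta>] by (simp_all add: algebra_simps)

text \<open>With \<open>x = \<bar>b\<bar>\<close> and \<open>e = \<bar>s\<bar>\<close>, the new value is at most \<open>x - x * e\<^sup>2 / 2 + 2 * e\<close>. It exceeds \<open>x\<close> only
  when \<open>x * e < 4\<close>, and then the cube grows by \<open>O(1 / e)\<close>.\<close>

lemma cube_growth_bound:
  fixes b c g s :: real
  assumes cs: "c\<^sup>2 + s\<^sup>2 = 1" and "s \<noteq> 0" and g: "\<bar>g\<bar> \<le> 2"
  shows "\<bar>b * c + g * s\<bar> ^ 3 \<le> \<bar>b\<bar> ^ 3 + 152 / \<bar>s\<bar>"
proof -
  define e where "e = \<bar>s\<bar>"
  define x where "x = \<bar>b\<bar>"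
  have e: "0 < e" using \<open>s \<noteq> 0\<close> by (simp add: e_def)
  have x: "0 \<le> x" by (simp add: x_def)
  have e2: "e\<^sup>2 = 1 - c\<^sup>2" using cs by (simp add: e_def)
  then have e1: "e \<le> 1"
    using e power2_le_imp_le[of e 1] by simp
  \<comment> \<open>Comparing squares gives
    \<open>|c| = sqrt (1 - e^2) <= 1 - e^2 / 2\<close>.\<close>
  have "(1 - e\<^sup>2 / 2)\<^sup>2 = 1 - e\<^sup>2 + (e\<^sup>2 / 2)\<^sup>2"
    by (simp add: power2_diff)
  then have "\<bar>c\<bar>\<^sup>2 \<le> (1 - e\<^sup>2 / 2)\<^sup>2"
    using e2 zero_le_power2[of "e\<^sup>2 / 2"] unfolding power2_abs by linarith
  moreover have "e\<^sup>2 \<le> 1" using e e1 by (simp add: power_le_one)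
  ultimately have c: "\<bar>c\<bar> \<le> 1 - e\<^sup>2 / 2"
    using power2_le_imp_le[of "\<bar>c\<bar>" "1 - e\<^sup>2 / 2"] by simp
  have "\<bar>b * c + g * s\<bar> \<le> x * \<bar>c\<bar> + \<bar>g\<bar> * e"
    unfolding x_def e_def by (metis abs_mult abs_triangle_ineq)
  also have "\<dots> \<le> x * (1 - e\<^sup>2 / 2) + 2 * e"
    using c g x e by (intro add_mono mult_left_mono mult_right_mono) auto
  finally have y: "\<bar>b * c + g * s\<bar> \<le> x - x * e\<^sup>2 / 2 + 2 * e" by (simp add: algebra_simps)
  show ?thesis
  proof (cases "x * e \<ge> 4")
    case True
    \<comment> \<open>The loss \<open>x * e^2 / 2\<close> is at least the gain \<open>2 * e\<close>,
      so the modulus does not grow.\<close>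
    then have "4 * e \<le> x * e\<^sup>2"
      using e by (simp add: power2_eq_square)
    with y have "\<bar>b * c + g * s\<bar> \<le> x" by simp
    then have "\<bar>b * c + g * s\<bar> ^ 3 \<le> x ^ 3" by (intro power_mono) auto
    then show ?thesis using e unfolding x_def e_def by (simp add: add_increasing2)
  next
    case False
    have inv: "e \<le> 1 / e"
      using e e1 by (simp add: field_simps mult_le_one)
    have "0 \<le> x * e\<^sup>2" using x by simp
    with y have "\<bar>b * c + g * s\<bar> \<le> x + 2 * e" by linarith
    then have "\<bar>b * c + g * s\<bar> ^ 3 \<le> (x + 2 * e) ^ 3" by (intro power_mono) auto
    also have "\<dots> = x ^ 3 + (6 * (x * e)\<^sup>2 / e + 12 * (x * e) * e + 8 * e\<^sup>2 * e)"
      using e by (simp add: power2_eq_square power3_eq_cube field_simps)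
    also have "\<dots> \<le> x ^ 3 + (6 * 4\<^sup>2 / e + 12 * 4 * e + 8 * 1 * e)"
      using False x e e1 \<open>e\<^sup>2 \<le> 1\<close>
      by (intro add_mono divide_right_mono mult_left_mono mult_right_mono power_mono) auto
    \<comment> \<open>Since \<open>e <= 1 / e\<close>, the three terms add up to at most
      \<open>(96 + 48 + 8) / e\<close>.\<close>
    also have "\<dots> \<le> x ^ 3 + 152 / e" using inv by simp
    finally show ?thesis by (simp add: x_def e_def)
  qed
qed

text \<open>Here \<open>(b, g)\<close> is the pair \<open>(\<beta>, \<gamma> + \<alpha>)\<close> just after the last projection of the block,
  \<open>k\<close> counts the rotations since then, and \<open>K\<close> the rotations before.\<close>

definition controlled :: "real \<Rightarrow> real \<Rightarrow> nat \<Rightarrow> real \<Rightarrow> real \<Rightarrow> real \<Rightarrow> bool" where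
  "controlled \<theta> D n \<alpha> \<beta> \<gamma> \<longleftrightarrow> \<bar>\<alpha>\<bar> \<le> 1 \<and>
     (\<exists>k K b g. K + k \<le> n \<and> \<bar>g\<bar> \<le> 2 \<and> \<bar>b\<bar> ^ 3 \<le> 1 + D * real K \<and>
        \<beta> = b * cos (real k * \<theta>) + g * sin (real k * \<theta>) \<and>
        \<gamma> + \<alpha> = - b * sin (real k * \<theta>) + g * cos (real k * \<theta>))"

lemma controlledI:
  assumes "\<bar>\<alpha>\<bar> \<le> 1" "K + k \<le> n" "\<bar>g\<bar> \<le> 2" "\<bar>b\<bar> ^ 3 \<le> 1 + D * real K"
    and "\<beta> = b * cos (real k * \<theta>) + g * sin (real k * \<theta>)"
    and "\<gamma> + \<alpha> = - b * sin (real k * \<theta>) + g * cos (real k * \<theta>)"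
  shows "controlled \<theta> D n \<alpha> \<beta> \<gamma>"
  unfolding controlled_def using assms by blast

lemma controlled_init:
  assumes "\<bar>\<alpha>\<bar> \<le> 1" "\<bar>\<beta>\<bar> \<le> 1" "\<bar>\<gamma>\<bar> \<le> 1"
  shows "controlled \<theta> D 0 \<alpha> \<beta> \<gamma>"
  by (rule controlledI[where k = 0 and K = 0 and b = \<beta> and g = "\<gamma> + \<alpha>"])
     (use assms in \<open>auto intro: power_le_one\<close>)

text \<open>\<open>n\<close> is only an upper bound for \<open>K + k\<close>, so it may be raised at
  a letter \<open>B0\<close>, which merely exchanges the blocks.\<close>

lemma controlled_Suc:
  "controlled \<theta> D n \<alpha> \<beta> \<gamma> \<Longrightarrow> controlled \<theta> D (Suc n) \<alpha> \<beta> \<gamma>"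
  unfolding controlled_def using le_SucI by blast

text \<open>By the addition formulas one more rotation raises \<open>k\<close> by 1 and leaves
  \<open>b\<close>, \<open>g\<close> and \<open>K\<close> alone.\<close>

lemma controlled_rotate:
  assumes "controlled \<theta> D n \<alpha> \<beta> \<gamma>"
  shows "controlled \<theta> D (Suc n) \<alpha> (\<beta> * cos \<theta> + (\<gamma> + \<alpha>) * sin \<theta>)
           (- \<beta> * sin \<theta> + (\<gamma> + \<alpha>) * cos \<theta> - \<alpha>)"
proof -
  from assms obtain k K b g where *: "\<bar>\<alpha>\<bar> \<le> 1" "K + k \<le> n" "\<bar>g\<bar> \<le> 2" "\<bar>b\<bar> ^ 3 \<le> 1 + D * real K"
    and \<beta>: "\<beta> = b * cos (real k * \<theta>) + g * sin (real k * \<theta>)"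
    and \<gamma>: "\<gamma> + \<alpha> = - b * sin (real k * \<theta>) + g * cos (real k * \<theta>)"
    unfolding controlled_def by blast
  show ?thesis
    by (rule controlledI[where k = "Suc k" and K = K and b = b and g = g])
       (use * in \<open>simp_all only: \<beta> \<gamma> sin_cos_Suc_mult, simp_all add: algebra_simps\<close>)
qed

text \<open>A projection ends a run of \<open>k\<close> rotations: \<open>\<beta>\<close> becomes
  the new \<open>b\<close>, \<open>k\<close> is added to \<open>K\<close>, and the new
  \<open>g\<close> is \<open>\<alpha>\<close> because \<open>\<gamma>\<close> is now 0. The cube
  grows by at most \<open>152 / |sin (k * \<theta>)|\<close>, which the hypothesis turns into
  \<open>(152 / \<delta>) * k\<close>.\<close>

lemma controlled_project:
  assumes bad: "\<And>k. k \<ge> 1 \<Longrightarrow> \<bar>sin (real k * \<theta>)\<bar> \<ge> \<delta> / real k" and "\<delta> > 0"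
    and "controlled \<theta> (152 / \<delta>) n \<alpha> \<beta> \<gamma>"
  shows "controlled \<theta> (152 / \<delta>) (Suc n) \<alpha> \<beta> 0"
proof -
  from assms(3) obtain k K b g where *: "\<bar>\<alpha>\<bar> \<le> 1" "K + k \<le> n" "\<bar>g\<bar> \<le> 2"
    and b: "\<bar>b\<bar> ^ 3 \<le> 1 + 152 / \<delta> * real K"
    and \<beta>: "\<beta> = b * cos (real k * \<theta>) + g * sin (real k * \<theta>)"
    unfolding controlled_def by blast
  have "\<bar>\<beta>\<bar> ^ 3 \<le> \<bar>b\<bar> ^ 3 + 152 / \<delta> * real k"
  \<comment> \<open>For \<open>k = 0\<close> the sine vanishes and \<open>cube_growth_bound\<close>
    does not apply, but then \<open>\<beta> = b\<close>.\<close>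
  proof (cases "k = 0")
    case True
    then show ?thesis by (simp add: \<beta>)
  next
    case False
    define s where "s = \<bar>sin (real k * \<theta>)\<bar>"
    have s: "\<delta> / real k \<le> s" using bad False by (simp add: s_def)
    have pos: "0 < \<delta> / real k" using False \<open>\<delta> > 0\<close> by simp
    with s have "s > 0" by linarith
    then have "\<bar>\<beta>\<bar> ^ 3 \<le> \<bar>b\<bar> ^ 3 + 152 / s"
      unfolding \<beta> s_def using * by (intro cube_growth_bound) auto
    also have "152 / s \<le> 152 / (\<delta> / real k)"
      using s pos by (intro divide_left_mono mult_pos_pos \<open>s > 0\<close>) auto
    finally show ?thesis by simp
  qed
  then have "\<bar>\<beta>\<bar> ^ 3 \<le> 1 + 152 / \<delta> * real (K + k)"
    using b by (simp add: algebra_simps add_divide_distrib)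
  with * show ?thesis
    by (intro controlledI[where k = 0 and K = "K + k" and b = \<beta> and g = \<alpha>]) auto
qed

lemma cube_powr_third: "0 \<le> x \<Longrightarrow> (x ^ 3) powr (1/3) = (x::real)"
  using root_powr_inverse[of 3 "x ^ 3"] real_root_power_cancel[of 3 x] by simp

text \<open>The cube root of \<open>1 + D * K <= (1 + D) * n\<close> bounds \<open>|b|\<close>; the
  summand 3 covers \<open>|g| <= 2\<close> and \<open>|\<alpha>| <= 1\<close>.\<close>

lemma controlled_bounds:
  assumes "controlled \<theta> D n \<alpha> \<beta> \<gamma>" "D \<ge> 0" "n \<ge> 1"
  defines "M \<equiv> ((1 + D) powr (1/3) + 3) * real n powr (1/3)"
  shows "\<bar>\<alpha>\<bar> \<le> M" "\<bar>\<beta>\<bar> \<le> M" "\<bar>\<gamma>\<bar> \<le> M"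
proof -
  from assms(1) obtain k K b g where \<alpha>: "\<bar>\<alpha>\<bar> \<le> 1" and K: "K + k \<le> n"
    and g: "\<bar>g\<bar> \<le> 2" and b: "\<bar>b\<bar> ^ 3 \<le> 1 + D * real K"
    and \<beta>: "\<beta> = b * cos (real k * \<theta>) + g * sin (real k * \<theta>)"
    and \<gamma>: "\<gamma> + \<alpha> = - b * sin (real k * \<theta>) + g * cos (real k * \<theta>)"
    unfolding controlled_def by blast
  have "D * real K \<le> D * real n" using K \<open>D \<ge> 0\<close> by (intro mult_left_mono) auto
  with b \<open>n \<ge> 1\<close> have "\<bar>b\<bar> ^ 3 \<le> (1 + D) * real n" by (simp add: algebra_simps)
  then have "(\<bar>b\<bar> ^ 3) powr (1/3) \<le> ((1 + D) * real n) powr (1/3)"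
    by (intro powr_mono2) auto
  then have b': "\<bar>b\<bar> \<le> (1 + D) powr (1/3) * real n powr (1/3)"
    using \<open>D \<ge> 0\<close> by (simp add: powr_mult cube_powr_third)
  have n1: "1 \<le> real n powr (1/3)" using \<open>n \<ge> 1\<close> by (simp add: ge_one_powr_ge_zero)
  with b' have M: "\<bar>b\<bar> + 3 \<le> M" by (simp add: M_def algebra_simps)
  show "\<bar>\<alpha>\<bar> \<le> M" using \<alpha> M by linarith
  have trig: "\<bar>x * cos t\<bar> \<le> \<bar>x\<bar>" "\<bar>x * sin t\<bar> \<le> \<bar>x\<bar>" for x t :: real
    by (simp_all add: abs_mult mult_left_le)
  show "\<bar>\<beta>\<bar> \<le> M"
    using M g trig(1)[of b "real k * \<theta>"] trig(2)[of g "real k * \<theta>"] unfolding \<beta> by linarith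
  show "\<bar>\<gamma>\<bar> \<le> M"
    using M g \<alpha> \<gamma> trig(2)[of b "real k * \<theta>"] trig(1)[of g "real k * \<theta>"] by (simp add: algebra_simps)
qed

text \<open>Both blocks are tracked at once since \<open>B0\<close> exchanges them. The row vector
  meets the letters from left to right, so the induction generalizes over \<open>n\<close> and
  \<open>v\<close>.\<close>

lemma controlled_product:
  assumes bad: "\<And>k. k \<ge> 1 \<Longrightarrow> \<bar>sin (real k * \<theta>)\<bar> \<ge> \<delta> / real k" and "\<delta> > 0"
    and "set As \<subseteq> {B0, B1 \<theta>}"
    and "controlled \<theta> (152 / \<delta>) n (v$1) (v$2) (v$3)" "controlled \<theta> (152 / \<delta>) n (v$4) (v$5) (v$6)"
    and "w = v v* foldr (**) As (mat 1)"
  shows "controlled \<theta> (152 / \<delta>) (n + length As) (w$1) (w$2) (w$3) \<and>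
         controlled \<theta> (152 / \<delta>) (n + length As) (w$4) (w$5) (w$6)"
  using assms(3-)
proof (induction As arbitrary: n v)
  case Nil
  then show ?case by simp
next
  case (Cons A As)
  let ?v = "v v* A"
  from Cons.prems(1) consider "A = B0" | "A = B1 \<theta>" by auto
  then have "controlled \<theta> (152 / \<delta>) (Suc n) (?v$1) (?v$2) (?v$3) \<and>
             controlled \<theta> (152 / \<delta>) (Suc n) (?v$4) (?v$5) (?v$6)"
  proof cases
    case 1
    with Cons.prems show ?thesis by (simp add: vector_mult_B0 controlled_Suc)
  next
    case 2
    have "controlled \<theta> (152 / \<delta>) (Suc n) (v$1) (v$2) 0"
      by (rule controlled_project[OF bad \<open>\<delta> > 0\<close> Cons.prems(2)])
    moreover have "controlled \<theta> (152 / \<delta>) (Suc n) (v$4) (v$5 * cos \<theta> + (v$6 + v$4) * sin \<theta>)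
       (- v$5 * sin \<theta> + (v$6 + v$4) * cos \<theta> - v$4)"
      by (rule controlled_rotate[OF Cons.prems(3)])
    ultimately show ?thesis by (simp only: 2 vector_mult_B1 vector_6 simp_thms)
  qed
  then show ?case
    using Cons.IH[of "Suc n" ?v] Cons.prems by (simp add: vector_matrix_mul_assoc)
qed

lemma product_entries_upper:
  assumes bad: "\<And>k. k \<ge> 1 \<Longrightarrow> \<bar>sin (real k * \<theta>)\<bar> \<ge> \<delta> / real k" and "\<delta> > 0"
    and A: "A \<in> matrix_products {B0, B1 \<theta>} n" and "n \<ge> 1"
  shows "\<bar>A$i$j\<bar> \<le> ((1 + 152 / \<delta>) powr (1/3) + 3) * real n powr (1/3)"
proof -
  from A obtain As where As: "A = foldr (**) As (mat 1)" "length As = n" "set As \<subseteq> {B0, B1 \<theta>}"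
    by (auto simp: matrix_products_def)
  define w where "w = axis i 1 v* A"
  have ax: "\<bar>axis i (1::real) $ l\<bar> \<le> 1" for l by (simp add: axis_def)
  \<comment> \<open>Row \<open>i\<close> of the product is the image of a unit vector, whose entries
    satisfy \<open>controlled_init\<close>.\<close>
  have w: "controlled \<theta> (152 / \<delta>) n (w$1) (w$2) (w$3) \<and> controlled \<theta> (152 / \<delta>) n (w$4) (w$5) (w$6)"
    using controlled_product[OF bad \<open>\<delta> > 0\<close> As(3) controlled_init controlled_init, OF _ ax ax ax ax ax ax w_def[unfolded As(1)]]
    by (simp add: As(2))
  have D: "152 / \<delta> \<ge> 0" using \<open>\<delta> > 0\<close> by simp
  have "\<forall>j. \<bar>w$j\<bar> \<le> ((1 + 152 / \<delta>) powr (1/3) + 3) * real n powr (1/3)"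
    unfolding forall_6 using w by (intro conjI; meson controlled_bounds D \<open>n \<ge> 1\<close>)
  moreover have "w $ j = A $ i $ j"
    by (simp add: w_def axis_vector_matrix_mult)
  ultimately show ?thesis by metis
qed

section \<open>Diophantine approximation of \<open>sqrt 2\<close>\<close>

text \<open>Irrationality of \<open>sqrt 2\<close> in integer form, by descent from \<open>k\<close>
  to a smaller \<open>a\<close> with \<open>k^2 = 2 * a^2\<close>.\<close>

lemma square_eq_double_square_nat:
  "i\<^sup>2 = 2 * k\<^sup>2 \<Longrightarrow> k = (0::nat)"
proof (induction k arbitrary: i rule: less_induct)
  case (less k)
  have "even i" using less.prems by (metis dvd_triv_left even_power)
  then obtain a where "i = 2 * a" by blast
  with less.prems have a: "k\<^sup>2 = 2 * a\<^sup>2" by (simp add: power_mult_distrib)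
  show ?case
  proof (rule ccontr)
    assume "k \<noteq> 0"
    with a have "a\<^sup>2 < k\<^sup>2" by (cases "a = 0") auto
    then have "a < k" by (simp add: power2_less_imp_less)
    from less.IH[OF this a] a \<open>k \<noteq> 0\<close> show False by simp
  qed
qed

text \<open>By concavity on [0, pi] the graph of the sine lies above its chord from 0 to pi /
  2.\<close>

lemma sin_pi_mult_ge:
  assumes "0 \<le> x" "x \<le> 1/2"
  shows "2 * x \<le> sin (pi * x)"
proof -
  have "concave_on {0..pi} sin"
    by (rule f''_le0_imp_concave[where f' = cos and f'' = "\<lambda>x. - sin x"])
       (auto intro!: derivative_eq_intros simp: sin_ge_zero)
  from concave_onD[OF this, of "2 * x" 0 "pi / 2"] assms
  show ?thesis by (simp add: algebra_simps)
qed

text \<open>Subtracting the nearest integer from \<open>t\<close> changes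
  \<open>sin (pi * t)\<close> at most by sign and brings the argument into the range of the chord
  bound.\<close>

lemma abs_sin_pi_mult_ge:
  fixes t :: real
  shows "2 * \<bar>t - of_int (round t)\<bar> \<le> \<bar>sin (pi * t)\<bar>"
proof -
  define x where "x = t - of_int (round t)"
  have "\<bar>x\<bar> \<le> 1/2" unfolding x_def using of_int_round_abs_le[of t] by (simp add: abs_minus_commute)
  then have "2 * \<bar>x\<bar> \<le> sin (pi * \<bar>x\<bar>)" by (intro sin_pi_mult_ge) auto
  also have "\<dots> \<le> \<bar>sin (pi * x)\<bar>" by (cases "x \<ge> 0") auto
  also have "sin (pi * x) = sin (pi * t) * cos (pi * of_int (round t))"
    by (simp add: x_def algebra_simps sin_diff)
  also have "\<bar>\<dots>\<bar> = \<bar>sin (pi * t)\<bar>" by (simp add: abs_mult)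
  finally show ?thesis by (simp add: x_def)
qed

text \<open>For \<open>t = 2 * sqrt 2 * k\<close> and its nearest integer \<open>j\<close>,
  \<open>t^2 - j^2 = 8 * k^2 - j^2\<close> is a nonzero integer. It factors as
  \<open>(t - j) * (t + j)\<close> with \<open>|t + j| <= 8 * k\<close>, so \<open>|t - j|\<close>
  is at least \<open>1 / (8 * k)\<close>.\<close>

lemma sin_sqrt2_badly_approximable:
  assumes "k \<ge> 1"
  shows "(1/4) / real k \<le> \<bar>sin (real k * (2 * pi * sqrt 2))\<bar>"
proof -
  define t where "t = 2 * sqrt 2 * real k"
  define j where "j = round t"
  have t2: "t\<^sup>2 = real_of_int (8 * int k ^ 2)" by (simp add: t_def power_mult_distrib)
  have "sqrt 2 < 3/2" by (rule real_less_lsqrt) (simp_all add: power2_eq_square)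
  then have t: "0 \<le> t" "t \<le> 3 * real k" by (auto simp: t_def intro!: mult_right_mono)
  have tj: "\<bar>t + j\<bar> \<le> 8 * real k"
    using t assms of_int_round_abs_le[of t] unfolding j_def by linarith
  have "8 * int k ^ 2 \<noteq> j ^ 2"
  proof
    assume "8 * int k ^ 2 = j ^ 2"
    then have "int ((nat \<bar>j\<bar>)\<^sup>2) = int (2 * (2 * k)\<^sup>2)" by (simp add: power_mult_distrib)
    then have "(nat \<bar>j\<bar>)\<^sup>2 = 2 * (2 * k)\<^sup>2" by (simp only: of_nat_eq_iff)
    from square_eq_double_square_nat[OF this] assms show False by simp
  qed
  then have "1 \<le> \<bar>8 * int k ^ 2 - j ^ 2\<bar>" by linarith
  then have "1 \<le> \<bar>real_of_int (8 * int k ^ 2 - j ^ 2)\<bar>" by linarith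
  also have "real_of_int (8 * int k ^ 2 - j ^ 2) = (t - j) * (t + j)"
    using t2 by (simp add: algebra_simps power2_eq_square)
  also have "\<bar>(t - j) * (t + j)\<bar> \<le> \<bar>t - j\<bar> * (8 * real k)"
    unfolding abs_mult using tj by (intro mult_left_mono) auto
  finally have "1/4 / real k \<le> 2 * \<bar>t - j\<bar>" using assms by (simp add: field_simps)
  also have "\<dots> \<le> \<bar>sin (pi * t)\<bar>" unfolding j_def by (rule abs_sin_pi_mult_ge)
  finally show ?thesis by (simp add: t_def mult_ac)
qed

lemma sin_sqrt2_approximation:
  assumes "N \<ge> 1"
  obtains k where "1 \<le> k" "k \<le> 12 * N"
    and "\<bar>sin (real k * (2 * pi * sqrt 2))\<bar> \<le> (2/3) / real N"
    and "0 \<le> cos (real k * (2 * pi * sqrt 2))"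
proof -
  \<comment> \<open>The parameter \<open>12 * N\<close> ensures
    \<open>2 * pi / (12 * N) < 8 / (12 * N) = (2/3) / N\<close>.\<close>
  obtain h k where k: "0 < k" "k \<le> int (12 * N)" and hk: "\<bar>of_int k * sqrt 2 - of_int h\<bar> < 1 / real (12 * N)"
    by (rule Dirichlet_approx[of "12 * N"]) (use assms in auto)
  define x where "x = 2 * pi * (of_int k * sqrt 2 - of_int h)"
  have eq: "real (nat k) * (2 * pi * sqrt 2) = x + 2 * pi * of_int h"
    using k by (simp add: x_def algebra_simps)
  have "\<bar>x\<bar> = 2 * pi * \<bar>of_int k * sqrt 2 - of_int h\<bar>" by (simp add: x_def abs_mult)
  also have "\<dots> \<le> 8 * (1 / real (12 * N))"
    using hk pi_less_4 by (intro mult_mono) auto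
  finally have x: "\<bar>x\<bar> \<le> (2/3) / real N" by simp
  also have "\<dots> \<le> 2/3" using assms by (simp add: field_simps)
  finally have "\<bar>x\<bar> \<le> pi / 2" using pi_gt3 by linarith
  then have "0 \<le> cos x" by (intro cos_ge_zero) auto
  moreover have "\<bar>sin x\<bar> \<le> (2/3) / real N" using abs_sin_x_le_abs_x[of x] x by linarith
  moreover have "sin (real (nat k) * (2 * pi * sqrt 2)) = sin x" "cos (real (nat k) * (2 * pi * sqrt 2)) = cos x"
    unfolding eq by (simp_all add: sin_add cos_add)
  moreover have "1 \<le> nat k" "nat k \<le> 12 * N" using k by auto
  ultimately show ?thesis using that[of "nat k"] by metis
qed

section \<open>Large entries from periodic words\<close>

text \<open>From \<open>c^2 <= c\<close> follows \<open>c >= 1 - s^2\<close>, and Bernoulli's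
  inequality then keeps every \<open>c^i\<close> with \<open>i < m\<close> at least 1/2.\<close>

lemma geometric_sum_lower:
  fixes c s :: real
  assumes "c\<^sup>2 + s\<^sup>2 = 1" "0 \<le> c" "real m * s\<^sup>2 \<le> 1/2"
  shows "\<bar>s\<bar> * real m / 2 \<le> \<bar>s * (\<Sum>i<m. c ^ i)\<bar>"
proof -
  have "c\<^sup>2 \<le> 1" "s\<^sup>2 \<le> 1" using assms(1) zero_le_power2[of s] zero_le_power2[of c] by linarith+
  then have "c \<le> 1" using assms(2) power2_le_imp_le[of c 1] by simp
  then have "c\<^sup>2 \<le> c" using assms(2) by (simp add: power2_eq_square mult_left_le)
  then have c: "1 - s\<^sup>2 \<le> c" using assms(1) by linarith
  have "1/2 \<le> c ^ i" if "i < m" for i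
  proof -
    have "real i * s\<^sup>2 \<le> real m * s\<^sup>2" using that by (intro mult_right_mono) auto
    then have "1/2 \<le> 1 + real i * (- s\<^sup>2)" using assms(3) by simp
    also have "\<dots> \<le> (1 + - s\<^sup>2) ^ i" using \<open>s\<^sup>2 \<le> 1\<close> by (intro Bernoulli_inequality) simp
    also have "\<dots> \<le> c ^ i" using c \<open>s\<^sup>2 \<le> 1\<close> by (intro power_mono) auto
    finally show ?thesis .
  qed
  then have "(\<Sum>i<m. 1/2) \<le> (\<Sum>i<m. c ^ i)" by (intro sum_mono) auto
  then have "\<bar>s\<bar> * (real m / 2) \<le> \<bar>s\<bar> * \<bar>\<Sum>i<m. c ^ i\<bar>" by (intro mult_left_mono) auto
  then show ?thesis by (simp add: abs_mult)
qed

lemma foldr_matrix_mult_append: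
  "foldr (**) (As @ Bs) (mat 1) = foldr (**) As (mat 1) ** foldr (**) Bs (mat (1::real))"
  by (induction As) (simp_all add: matrix_mul_assoc)

text \<open>In the coordinates \<open>(\<beta>, \<gamma> + \<alpha>)\<close> the second block is
  simply rotated by \<open>k * \<theta>\<close>.\<close>

lemma B1_power_row:
  "vector [0, 0, 0, \<alpha>, \<beta>, \<gamma>] v* foldr (**) (replicate k (B1 \<theta>)) (mat 1) =
   vector [0, 0, 0, \<alpha>, \<beta> * cos (real k * \<theta>) + (\<gamma> + \<alpha>) * sin (real k * \<theta>),
     - \<beta> * sin (real k * \<theta>) + (\<gamma> + \<alpha>) * cos (real k * \<theta>) - \<alpha>]"
proof (induction k arbitrary: \<beta> \<gamma>)
  case 0
  then show ?case by simp
next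
  case (Suc k)
  have "vector [0, 0, 0, \<alpha>, \<beta>, \<gamma>] v* foldr (**) (replicate (Suc k) (B1 \<theta>)) (mat 1) =
    (vector [0, 0, 0, \<alpha>, \<beta>, \<gamma>] v* B1 \<theta>) v* foldr (**) (replicate k (B1 \<theta>)) (mat 1)"
    by (simp add: vector_matrix_mul_assoc)
  then show ?case
    by (simp only: vector_mult_B1 vector_6 Suc.IH sin_cos_Suc_mult) (simp add: vec_eq_iff forall_6 algebra_simps)
qed

text \<open>On the first block this word acts as the projection followed by \<open>k\<close> rotations.\<close>

definition period_word :: "real \<Rightarrow> nat \<Rightarrow> (real^6^6) list" where
  "period_word \<theta> k = [B1 \<theta>, B0] @ replicate k (B1 \<theta>) @ [B0]"

text \<open>The leading projection erases \<open>\<gamma>\<close>, so a period acts on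
  \<open>\<beta>\<close> by an affine map in \<open>\<beta>\<close> alone; iterating it yields a
  geometric sum.\<close>

lemma period_word_row:
  "vector [1, \<beta>, \<gamma>, 0, 0, 0] v* foldr (**) (period_word \<theta> k) (mat 1) =
   vector [1, \<beta> * cos (real k * \<theta>) + sin (real k * \<theta>),
     - \<beta> * sin (real k * \<theta>) + cos (real k * \<theta>) - 1, 0, 0, 0]"
  unfolding period_word_def foldr_matrix_mult_append
  by (simp add: vector_mult_B0 vector_mult_B1 B1_power_row del: foldr_replicate flip: vector_matrix_mul_assoc)

lemma period_word_power_row:
  "\<exists>\<gamma>'. vector [1, \<beta>, \<gamma>, 0, 0, 0] v* foldr (**) (concat (replicate m (period_word \<theta> k))) (mat 1) =
   vector [1, \<beta> * cos (real k * \<theta>) ^ m + sin (real k * \<theta>) * (\<Sum>i<m. cos (real k * \<theta>) ^ i), \<gamma>', 0, 0, 0]"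
proof (induction m arbitrary: \<beta> \<gamma>)
  case 0
  then show ?case by auto
next
  case (Suc m)
  have "vector [1, \<beta>, \<gamma>, 0, 0, 0] v* foldr (**) (concat (replicate (Suc m) (period_word \<theta> k))) (mat 1) =
    (vector [1, \<beta>, \<gamma>, 0, 0, 0] v* foldr (**) (period_word \<theta> k) (mat 1)) v*
      foldr (**) (concat (replicate m (period_word \<theta> k))) (mat 1)"
    unfolding replicate_Suc concat.simps foldr_matrix_mult_append by (simp add: vector_matrix_mul_assoc)
  then show ?case
    unfolding period_word_row
    using Suc.IH[of "\<beta> * cos (real k * \<theta>) + sin (real k * \<theta>)" "- \<beta> * sin (real k * \<theta>) + cos (real k * \<theta>) - 1"]
    by (simp add: algebra_simps)
qed

text \<open>\<open>B0\<close> is an involution. Its powers pad a word to any length while at most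
  exchanging the blocks.\<close>

lemma B0_power_row:
  "v v* foldr (**) (replicate r B0) (mat 1) \<in> {v, vector [v$4, v$5, v$6, v$1, v$2, v$3]}"
proof (induction r)
  case (Suc r)
  have "foldr (**) (replicate (Suc r) B0) (mat 1) = foldr (**) (replicate r B0) (mat 1) ** B0"
    unfolding replicate_append_same[symmetric] replicate_Suc foldr_matrix_mult_append by simp
  then have "v v* foldr (**) (replicate (Suc r) B0) (mat 1) = (v v* foldr (**) (replicate r B0) (mat 1)) v* B0"
    by (simp add: vector_matrix_mul_assoc)
  with Suc.IH show ?case by (auto simp: vector_mult_B0 vec_eq_iff forall_6)
qed simp

text \<open>Row 1 starts from \<open>\<beta> = \<gamma> = 0\<close>, so only the geometric sum
  remains. The entry 1 is the preserved \<open>\<alpha>\<close>; it later absorbs an additive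
  constant.\<close>

lemma product_entries_periodic:
  "\<exists>A \<in> matrix_products {B0, B1 \<theta>} (m * (k + 3) + r).
     (\<exists>i j. A$i$j = 1) \<and> (\<exists>i j. A$i$j = sin (real k * \<theta>) * (\<Sum>i<m. cos (real k * \<theta>) ^ i))"
proof -
  define Ps where "Ps = concat (replicate m (period_word \<theta> k))"
  define As where "As = Ps @ replicate r B0"
  define A where "A = foldr (**) As (mat 1)"
  have e1: "vector [1, 0, 0, 0, 0, 0] = (axis 1 1 :: real^6)"
    by (simp add: vec_eq_iff forall_6 axis_def)
  obtain \<gamma>' where "vector [1, 0, 0, 0, 0, 0] v* foldr (**) Ps (mat 1) =
     vector [1, sin (real k * \<theta>) * (\<Sum>i<m. cos (real k * \<theta>) ^ i), \<gamma>', 0, 0, 0]" (is "_ = ?u")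
    using period_word_power_row[of 0 0 m \<theta> k] by (auto simp: Ps_def)
  then have "axis 1 1 v* A = ?u v* foldr (**) (replicate r B0) (mat 1)"
    unfolding A_def As_def foldr_matrix_mult_append e1 by (simp flip: vector_matrix_mul_assoc)
  with B0_power_row[of ?u r] have "axis 1 1 v* A \<in> {?u, vector [0, 0, 0, ?u$1, ?u$2, ?u$3]}" by simp
  moreover have "(axis 1 1 v* A) $ j = A $ 1 $ j" for j
    by (rule axis_vector_matrix_mult)
  \<comment> \<open>The padding leaves the row in the first block or moves it to the second.\<close>
  ultimately have "A$1$1 = 1 \<and> A$1$2 = ?u$2 \<or> A$1$4 = 1 \<and> A$1$5 = ?u$2"
    by (metis (no_types, lifting) insertE singletonD vector_6)
  moreover have "length (concat (replicate m (period_word \<theta> k))) = m * (k + 3)"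
    by (induction m) (simp_all add: period_word_def)
  then have "length As = m * (k + 3) + r" by (simp add: As_def Ps_def)
  moreover have "set As \<subseteq> {B0, B1 \<theta>}"
    by (auto simp: As_def Ps_def period_word_def)
  ultimately show ?thesis
    by (intro bexI[of _ A]) (auto simp: matrix_products_def A_def)
qed

section \<open>Comparison of norms\<close>

text \<open>The values on the basis give the upper constant and hence a Lipschitz bound; the minimum
  on the compact unit sphere, positive by definiteness, is the lower constant.\<close>

lemma is_norm_equivalent_norm:
  fixes N :: "'a::euclidean_space \<Rightarrow> real"
  assumes "is_norm N"
  obtains c C where "c > 0" "C > 0" "\<And>x. c * norm x \<le> N x" "\<And>x. N x \<le> C * norm x"
proof -
  have N: "\<And>x. 0 \<le> N x" "\<And>x. N x = 0 \<longleftrightarrow> x = 0" "\<And>c x. N (c *\<^sub>R x) = \<bar>c\<bar> * N x"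
    "\<And>x y. N (x + y) \<le> N x + N y"
    using assms unfolding is_norm_def by blast+
  define C where "C = (\<Sum>b\<in>Basis. N b) + (1::real)"
  have S0: "0 \<le> (\<Sum>b\<in>Basis. N (b::'a))" by (intro sum_nonneg) (use N in auto)
  then have C: "C > 0" by (simp add: C_def)
  have upper: "N x \<le> C * norm x" for x
  proof -
    have Nsum: "N (\<Sum>b\<in>A. f b) \<le> (\<Sum>b\<in>A. N (f b))" if "finite A" for A and f :: "'a \<Rightarrow> 'a"
      using that
    proof (induction A rule: finite_induct)
      case empty
      then show ?case using N(2)[of 0] by simp
    next
      case (insert a A)
      have "N (f a + (\<Sum>b\<in>A. f b)) \<le> N (f a) + N (\<Sum>b\<in>A. f b)" by (rule N)
      with insert show ?case by simp
    qed
    have "N x = N (\<Sum>b\<in>Basis. (x \<bullet> b) *\<^sub>R b)" by (simp add: euclidean_representation)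
    also have "\<dots> \<le> (\<Sum>b\<in>Basis. N ((x \<bullet> b) *\<^sub>R b))" by (rule Nsum) simp
    also have "\<dots> = (\<Sum>b\<in>Basis. \<bar>x \<bullet> b\<bar> * N b)" using N by simp
    also have "\<dots> \<le> (\<Sum>b\<in>Basis. norm x * N b)"
      using N by (intro sum_mono mult_right_mono Basis_le_norm) auto
    also have "\<dots> \<le> C * norm x"
      unfolding sum_distrib_left[symmetric] by (simp add: C_def algebra_simps)
    finally show ?thesis .
  qed
  have minus: "N (- x) = N x" for x
    using N(3)[of "-1" x] by simp
  have "\<bar>N x - N y\<bar> \<le> C * norm (x - y)" for x y
  proof -
    have "N x \<le> N (x - y) + N y" "N y \<le> N (y - x) + N x"
      using N(4)[of "x - y" y] N(4)[of "y - x" x] by simp_all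
    moreover have "N (y - x) = N (x - y)" using minus[of "x - y"] by simp
    ultimately show ?thesis using upper[of "x - y"] by linarith
  qed
  then have "C-lipschitz_on UNIV N"
    using C by (intro lipschitz_onI) (auto simp: dist_norm)
  then have cont: "continuous_on (sphere 0 1) N"
    by (meson continuous_on_subset lipschitz_on_continuous_on subset_UNIV)
  obtain b :: 'a where "b \<in> Basis" using nonempty_Basis by blast
  then have "sphere (0::'a) 1 \<noteq> {}" by (auto simp: sphere_def intro!: exI[of _ b])
  with cont obtain u :: 'a where u: "u \<in> sphere 0 1" "\<And>y. y \<in> sphere 0 1 \<Longrightarrow> N u \<le> N y"
    using continuous_attains_inf[of "sphere (0::'a) 1" N] by auto
  have "N u \<noteq> 0" using u(1) N by auto
  then have Nu: "N u > 0" using N(1)[of u] by linarith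
  have lower: "N u * norm x \<le> N x" for x
  proof (cases "x = 0")
    case True
    then show ?thesis using N by simp
  next
    case False
    then have "N u \<le> N ((1 / norm x) *\<^sub>R x)" by (intro u(2)) (simp add: dist_norm)
    also have "\<dots> = N x / norm x" using N by simp
    finally show ?thesis using False by (simp add: field_simps)
  qed
  show ?thesis using that[OF Nu C lower upper] .
qed

text \<open>Makes growth bounds for arbitrary norms applicable to the joint spectral radius.\<close>

lemma is_norm_operator_norm: "is_norm (operator_norm :: real^'n^'n \<Rightarrow> real)"
  unfolding is_norm_def operator_norm_def
proof (intro conjI allI)
  fix A B :: "real^'n^'n" and c :: real
  note bl = matrix_vector_mul_bounded_linear
  show "0 \<le> onorm ((*v) A)" by (rule onorm_pos_le[OF bl])
  show "onorm ((*v) A) = 0 \<longleftrightarrow> A = 0"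
    using onorm_eq_0[OF bl, of A] by (metis matrix_eq matrix_vector_mult_0)
  show "onorm ((*v) (c *\<^sub>R A)) = \<bar>c\<bar> * onorm ((*v) A)"
    using onorm_scaleR[OF bl, of c A] by (simp add: scaleR_matrix_vector_assoc)
  show "onorm ((*v) (A + B)) \<le> onorm ((*v) A) + onorm ((*v) B)"
    using onorm_triangle[OF bl bl, of A B] by (simp flip: matrix_vector_mult_add_rdistrib)
qed

lemma abs_entry_le_norm: "\<bar>A$i$j\<bar> \<le> norm (A :: real^'n^'m)"
  by (rule order_trans[OF component_le_norm_cart Finite_Cartesian_Product.norm_nth_le])

lemma norm_le_card_mult_entry_bound:
  fixes A :: "real^'n^'m"
  assumes "\<And>i j. \<bar>A$i$j\<bar> \<le> M"
  shows "norm A \<le> real (CARD('m) * CARD('n)) * M"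
proof -
  have "norm A \<le> (\<Sum>i\<in>UNIV. norm (A$i))"
    unfolding norm_vec_def by (rule L2_set_le_sum) simp
  also have "\<dots> \<le> (\<Sum>i\<in>(UNIV::'m set). \<Sum>j\<in>(UNIV::'n set). M)"
    by (intro sum_mono order_trans[OF norm_le_l1_cart]) (use assms in auto)
  finally show ?thesis by (simp add: mult_ac)
qed

section \<open>Growth of products in an arbitrary norm\<close>

text \<open>\<open>|sin (k * \<theta>)|\<close> is at most \<open>(2/3) / N\<close>, so damping
  stays harmless over \<open>N^2\<close> periods, and at least \<open>\<delta> / (12 * N)\<close>,
  so the sum still reaches order \<open>N\<close>. The left-over letters are
  \<open>B0\<close>.\<close>

lemma product_norm_lower:
  assumes bad: "\<And>k. k \<ge> 1 \<Longrightarrow> \<bar>sin (real k * \<theta>)\<bar> \<ge> \<delta> / real k" and "\<delta> > 0"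
    and approx: "\<And>N. N \<ge> 1 \<Longrightarrow> \<exists>k\<ge>1. k \<le> 12 * N \<and>
       \<bar>sin (real k * \<theta>)\<bar> \<le> (2/3) / real N \<and> 0 \<le> cos (real k * \<theta>)"
  shows "\<exists>A \<in> matrix_products {B0, B1 \<theta>} n. real n powr (1/3) \<le> (72 / \<delta> + 3) * norm A"
proof -
  \<comment> \<open>\<open>N\<^sup>2\<close> periods of length \<open>k + 3 \<le> 15 * N\<close> have to fit into \<open>n\<close> letters.\<close>
  define t where "t = root 3 (real n / 15)"
  define N where "N = nat \<lfloor>t\<rfloor>"
  have t: "0 \<le> t" "15 * t ^ 3 = real n" by (simp_all add: t_def)
  have N: "real N \<le> t" "t < real N + 1" using t(1) by (simp_all add: N_def)
  have "real N ^ 3 \<le> t ^ 3" using N by (intro power_mono) auto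
  then have "real (15 * N ^ 3) \<le> real n" unfolding t(2)[symmetric] by simp
  then have Nn: "15 * N ^ 3 \<le> n" by (simp only: of_nat_le_iff)
  have "t ^ 3 \<le> (real N + 1) ^ 3" using N t by (intro power_mono) auto
  \<comment> \<open>Rounding 15 up to \<open>3 ^ 3\<close> makes the right-hand side a perfect
    cube.\<close>
  then have "real n \<le> (3 * (real N + 1)) ^ 3" unfolding power_mult_distrib using t(2) by simp
  then have "real n powr (1/3) \<le> ((3 * (real N + 1)) ^ 3) powr (1/3)" by (intro powr_mono2) auto
  then have n3: "real n powr (1/3) \<le> 3 * real N + 3" by (subst (asm) cube_powr_third) auto
  obtain k where k: "N\<^sup>2 * (k + 3) \<le> n"
    and large: "\<delta> * real N / 24 \<le> \<bar>sin (real k * \<theta>) * (\<Sum>i<N\<^sup>2. cos (real k * \<theta>) ^ i)\<bar>"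
  \<comment> \<open>For \<open>N = 0\<close> there are no periods, and both sides of the bound are
    0.\<close>
  proof (cases "N = 0")
    case True
    then show ?thesis using that by simp
  next
    case False
    then obtain k where k: "1 \<le> k" "k \<le> 12 * N" and s: "\<bar>sin (real k * \<theta>)\<bar> \<le> (2/3) / real N"
      and c: "0 \<le> cos (real k * \<theta>)"
      using approx[of N] by auto
    have "k + 3 \<le> 15 * N" using k(2) False by linarith
    then have "N\<^sup>2 * (k + 3) \<le> N\<^sup>2 * (15 * N)" by (rule mult_left_mono) simp
    also have "\<dots> \<le> n" using Nn by (simp add: power2_eq_square power3_eq_cube)
    finally have len: "N\<^sup>2 * (k + 3) \<le> n" .
    have "\<bar>sin (real k * \<theta>)\<bar>\<^sup>2 \<le> ((2/3) / real N)\<^sup>2" using s by (intro power_mono) auto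
    then have "real (N\<^sup>2) * (sin (real k * \<theta>))\<^sup>2 \<le> real (N\<^sup>2) * ((2/3) / real N)\<^sup>2"
      by (intro mult_left_mono) auto
    \<comment> \<open>The product is \<open>(2/3)^2 = 4/9\<close>, below the threshold of
      \<open>geometric_sum_lower\<close>.\<close>
    also have "\<dots> \<le> 1/2" using False by (simp add: power_divide)
    finally have "\<bar>sin (real k * \<theta>)\<bar> * real (N\<^sup>2) / 2 \<le> \<bar>sin (real k * \<theta>) * (\<Sum>i<N\<^sup>2. cos (real k * \<theta>) ^ i)\<bar>"
      using c by (intro geometric_sum_lower) auto
    moreover have "\<delta> / real (12 * N) \<le> \<delta> / real k"
      using k \<open>\<delta> > 0\<close> False by (intro divide_left_mono) auto
    with bad[OF k(1)] have "\<delta> / real (12 * N) \<le> \<bar>sin (real k * \<theta>)\<bar>" by linarith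
    then have "\<delta> / real (12 * N) * real (N\<^sup>2) / 2 \<le> \<bar>sin (real k * \<theta>)\<bar> * real (N\<^sup>2) / 2"
      by (intro divide_right_mono mult_right_mono) auto
    moreover have "\<delta> / real (12 * N) * real (N\<^sup>2) / 2 = \<delta> * real N / 24"
      using False by (simp add: power2_eq_square)
    ultimately show ?thesis using that[OF len] by linarith
  qed
  obtain A where A: "A \<in> matrix_products {B0, B1 \<theta>} n" and one: "\<exists>i j. A$i$j = 1"
    and big: "\<exists>i j. A$i$j = sin (real k * \<theta>) * (\<Sum>i<N\<^sup>2. cos (real k * \<theta>) ^ i)"
    using product_entries_periodic[of \<theta> "N\<^sup>2" k "n - N\<^sup>2 * (k + 3)"] k by auto
  \<comment> \<open>This covers the summand 3 of \<open>3 * N + 3\<close>, in particular when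
    \<open>N = 0\<close>.\<close>
  have "1 \<le> norm A" using one abs_entry_le_norm[of A] by (metis abs_one)
  moreover have "\<delta> * real N / 24 \<le> norm A" using big large abs_entry_le_norm[of A] by (metis order_trans)
  then have "3 * real N \<le> 72 / \<delta> * norm A" using \<open>\<delta> > 0\<close> by (simp add: field_simps)
  ultimately have "real n powr (1/3) \<le> (72 / \<delta> + 3) * norm A"
    using n3 unfolding distrib_right by linarith
  with A show ?thesis by blast
qed

lemma product_growth:
  assumes "is_norm N"
  defines "\<theta> \<equiv> 2 * pi * sqrt 2"
  obtains c C where "c > 0" "C > 0"
    "\<And>n A. n \<ge> 1 \<Longrightarrow> A \<in> matrix_products {B0, B1 \<theta>} n \<Longrightarrow> N A \<le> C * real n powr (1/3)"
    "\<And>n. \<exists>A \<in> matrix_products {B0, B1 \<theta>} n. c * real n powr (1/3) \<le> N A"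
proof -
  have bad: "\<bar>sin (real k * \<theta>)\<bar> \<ge> (1/4) / real k" if "k \<ge> 1" for k
    unfolding \<theta>_def by (rule sin_sqrt2_badly_approximable[OF that])
  have approx: "\<exists>k\<ge>1. k \<le> 12 * N \<and> \<bar>sin (real k * \<theta>)\<bar> \<le> (2/3) / real N \<and> 0 \<le> cos (real k * \<theta>)"
    if "N \<ge> 1" for N
    unfolding \<theta>_def using sin_sqrt2_approximation[OF that] by metis
  obtain c C where cC: "c > 0" "C > 0" "\<And>x. c * norm x \<le> N x" "\<And>x. N x \<le> C * norm x"
    using is_norm_equivalent_norm[OF assms(1)] by metis
  define M where "M = (1 + 152 / (1/4)) powr (1/3) + (3::real)"
  have M: "M > 0" by (simp add: M_def add_pos_pos)
  define L where "L = 72 / (1/4) + (3::real)"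
  have L: "L > 0" by (simp add: L_def)
  show ?thesis
  proof (rule that[of "c / L" "C * (36 * M)"])
    show "c / L > 0" "C * (36 * M) > 0" using cC L M by auto
    show "N A \<le> C * (36 * M) * real n powr (1/3)"
      if "n \<ge> 1" "A \<in> matrix_products {B0, B1 \<theta>} n" for n A
    proof -
      have "\<bar>A$i$j\<bar> \<le> M * real n powr (1/3)" for i j
        unfolding M_def by (rule product_entries_upper[OF bad _ that(2,1)]) auto
      then have "norm A \<le> 36 * (M * real n powr (1/3))"
        using norm_le_card_mult_entry_bound[of A] by fastforce
      then have "C * norm A \<le> C * (36 * (M * real n powr (1/3)))"
        using cC by (intro mult_left_mono) auto
      with cC(4)[of A] show ?thesis by (simp add: mult_ac)
    qed
    show "\<exists>A \<in> matrix_products {B0, B1 \<theta>} n. c / L * real n powr (1/3) \<le> N A" for n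
    proof -
      obtain A where A: "A \<in> matrix_products {B0, B1 \<theta>} n" "real n powr (1/3) \<le> L * norm A"
        using product_norm_lower[OF bad _ approx, of n] by (auto simp: L_def)
      then have "c * real n powr (1/3) \<le> c * (L * norm A)" using cC by (intro mult_left_mono) auto
      then have "c / L * real n powr (1/3) \<le> c * norm A" using L by (simp add: field_simps)
      with cC(3)[of A] A(1) show ?thesis by (meson order_trans)
    qed
  qed
qed

section \<open>Joint spectral radius and instability rate\<close>

text \<open>Both \<open>root n c\<close> and \<open>root n n\<close> tend to 1.\<close>

lemma polynomial_powr_inverse_tendsto:
  assumes "c > 0"
  shows "(\<lambda>n. (c * real n powr a) powr (1 / real n)) \<longlonglongrightarrow> 1"
proof -
  have "(\<lambda>n. root n c * root n (real n) powr a) \<longlonglongrightarrow> 1 * 1 powr a"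
    using LIMSEQ_root_const[OF assms] LIMSEQ_root by (intro tendsto_intros) auto
  then have "(\<lambda>n. root n c * root n (real n) powr a) \<longlonglongrightarrow> 1" by simp
  moreover have "\<forall>\<^sub>F n in sequentially. root n c * root n (real n) powr a = (c * real n powr a) powr (1 / real n)"
    using eventually_gt_at_top[of 0]
    by eventually_elim (use assms in \<open>simp add: root_powr_inverse powr_mult powr_powr mult.commute\<close>)
  ultimately show ?thesis by (rule Lim_transform_eventually)
qed

theorem corollary6p1:
  shows "\<exists>\<theta>::real.
    joint_spectral_radius {B0, B1 \<theta>} = 1 \<and>
    (\<forall>N :: real^6^6 \<Rightarrow> real. is_norm N \<longrightarrow>
       marginal_instability_rate N {B0, B1 \<theta>} \<simeq> (\<lambda>n. real n powr (1/3)))"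
proof (intro exI conjI allI impI)
  define \<theta> where "\<theta> = 2 * pi * sqrt 2"
  let ?P = "matrix_products {B0, B1 \<theta>}"
  have fin: "finite (?P n)" and ne: "?P n \<noteq> {}" for n
    by (simp_all add: finite_matrix_products matrix_products_nonempty)
  \<comment> \<open>Showing this goal fixes the witness that \<open>exI\<close> left
    schematic.\<close>
  show "joint_spectral_radius {B0, B1 (2 * pi * sqrt 2)} = 1"
    unfolding joint_spectral_radius_def \<theta>_def[symmetric]
  proof (rule limI)
    obtain c C where c: "c > 0" and C: "C > 0"
      and upper: "\<And>n A. n \<ge> 1 \<Longrightarrow> A \<in> ?P n \<Longrightarrow> operator_norm A \<le> C * real n powr (1/3)"
      and lower: "\<And>n. \<exists>A \<in> ?P n. c * real n powr (1/3) \<le> operator_norm A"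
      using product_growth[OF is_norm_operator_norm] unfolding \<theta>_def by metis
    have nonneg: "0 \<le> operator_norm (A :: real^6^6)" for A
      using is_norm_operator_norm unfolding is_norm_def by blast
    let ?f = "\<lambda>n. SUP A\<in>?P n. operator_norm A powr (1 / real n)"
    have "(c * real n powr (1/3)) powr (1 / real n) \<le> ?f n" for n
    proof -
      obtain A where A: "A \<in> ?P n" "c * real n powr (1/3) \<le> operator_norm A" using lower by blast
      have "(c * real n powr (1/3)) powr (1 / real n) \<le> operator_norm A powr (1 / real n)"
        using A c by (intro powr_mono2) auto
      also have "\<dots> \<le> ?f n" using A fin by (intro cSUP_upper) auto
      finally show ?thesis .
    qed
    moreover have "?f n \<le> (C * real n powr (1/3)) powr (1 / real n)" if "n \<ge> 1" for n
      using ne upper[OF that] nonneg by (intro cSUP_least powr_mono2) auto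
    ultimately show "?f \<longlonglongrightarrow> 1"
      by (intro tendsto_sandwich[OF _ _ polynomial_powr_inverse_tendsto[OF c] polynomial_powr_inverse_tendsto[OF C]])
         (auto intro!: eventually_sequentiallyI)
  qed
  fix N :: "real^6^6 \<Rightarrow> real"
  assume "is_norm N"
  then obtain c C where c: "c > 0" and C: "C > 0"
    and upper: "\<And>n A. n \<ge> 1 \<Longrightarrow> A \<in> ?P n \<Longrightarrow> N A \<le> C * real n powr (1/3)"
    and lower: "\<And>n. \<exists>A \<in> ?P n. c * real n powr (1/3) \<le> N A"
    using product_growth unfolding \<theta>_def by metis
  define K where "K = max C (1 / c)"
  have K: "K > 0" "C \<le> K" "inverse K \<le> c" 
    using c C by (auto simp: K_def field_simps max_def)
  show "marginal_instability_rate N {B0, B1 (2 * pi * sqrt 2)} \<simeq> (\<lambda>n. real n powr (1/3))"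
    unfolding seq_equiv_def \<theta>_def[symmetric]
  proof (intro exI[of _ K] conjI allI impI K)
    fix n :: nat
    assume n: "n \<ge> 1"
    have rate: "marginal_instability_rate N {B0, B1 \<theta>} n = Max (N ` ?P n)"
      by (rule marginal_instability_rate_eq_Max) auto
    obtain A where A: "A \<in> ?P n" "c * real n powr (1/3) \<le> N A" using lower by blast
    have "inverse K * real n powr (1/3) \<le> c * real n powr (1/3)" using K by (intro mult_right_mono) auto
    also have "\<dots> \<le> N A" by (rule A)
    also have "\<dots> \<le> Max (N ` ?P n)" using A fin by (intro Max_ge) auto
    finally show "inverse K * real n powr (1/3) \<le> marginal_instability_rate N {B0, B1 \<theta>} n"
      by (simp add: rate)
    have "C * real n powr (1/3) \<le> K * real n powr (1/3)" using K by (intro mult_right_mono) auto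
    then have "N A \<le> K * real n powr (1/3)" if "A \<in> ?P n" for A
      using upper[OF n that] by linarith
    then show "marginal_instability_rate N {B0, B1 \<theta>} n \<le> K * real n powr (1/3)"
      unfolding rate using fin ne by (subst Max_le_iff) auto
  qed
qed

end
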